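(* Let $r\in\mathbb{N}$ be fixed and let $f\colon\mathbb{N}\to\mathbb{C}$ be an $r$-even function. i) If $x\in\mathbb{N}$ and $r\mid x$, then $$\sum_{n=1}^{x}\widehat{f}(n)=f(r)x.$$ ii) For any real $x\ge 1$, $$\sum_{n\le x}\widehat{f}(n)=f(r)x+T_f(x),\qquad |T_f(x)|\le\sum_{d\mid r}d\,|f'(r/d)|.$$ iii) The mean value of the function $\widehat{f}$ exists and equals $f(r)$, that is, $\lim_{x\to\infty}\frac1x\sum_{n\le x}\widehat{f}(n)=f(r)$.
   Context: $\mathbb{N}=\{1,2,\ldots\}$. A function $f\colon\mathbb{N}\to\mathbb{C}$ is $r$-even if $f(\gcd(n,r))=f(n)$ for all $n\in\mathbb{N}$ (in particular it is $r$-periodic). Its discrete Fourier transform is $\widehat{f}(n)=\sum_{k=1}^{r}f(k)\exp(-2\pi i kn/r)$, $n\in\mathbb{N}$. Also $f'=\mu*f$, where $\mu$ is the Möbius function and $(f*g)(n)=\sum_{d\mid n}f(d)g(n/d)$. The mean value of $g\colon\mathbb{N}\to\mathbb{C}$ is $m(g)=\lim_{x\to\infty}\frac1x\sum_{n\le x}g(n)$ if this limit exists. In ii), $T_f(x)$ is defined by the displayed equation. *)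

theory Defs
  imports Complex_Main "HOL-Computational_Algebra.Squarefree"
begin

text \<open>
  Functions on the positive integers are rendered as functions on \<^typ>\<open>nat\<close>; nothing is
  assumed about their value at 0, and no definition below evaluates them there.
\<close>

definition r_even :: "nat \<Rightarrow> (nat \<Rightarrow> complex) \<Rightarrow> bool" where
  "r_even r f \<longleftrightarrow> (\<forall>n>0. f (gcd n r) = f n)"

definition dft :: "nat \<Rightarrow> (nat \<Rightarrow> complex) \<Rightarrow> nat \<Rightarrow> complex" where
  "dft r f n = (\<Sum>k=1..r. f k * exp (- 2 * of_real pi * \<i> * of_nat k * of_nat n / of_nat r))"

definition moebius_mu :: "nat \<Rightarrow> complex" where
  "moebius_mu n = (if squarefree n then (- 1) ^ card (prime_factors n) else 0)"

definition dirichlet_conv :: "(nat \<Rightarrow> complex) \<Rightarrow> (nat \<Rightarrow> complex) \<Rightarrow> nat \<Rightarrow> complex" where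
  "dirichlet_conv f g n = (\<Sum>d | d dvd n. f d * g (n div d))"

definition moebius_transform :: "(nat \<Rightarrow> complex) \<Rightarrow> nat \<Rightarrow> complex" where
  "moebius_transform f = dirichlet_conv moebius_mu f"

definition sum_upto :: "(nat \<Rightarrow> complex) \<Rightarrow> real \<Rightarrow> complex" where
  "sum_upto g x = (\<Sum>n | 0 < n \<and> real n \<le> x. g n)"

definition dft_remainder :: "nat \<Rightarrow> (nat \<Rightarrow> complex) \<Rightarrow> real \<Rightarrow> complex" where
  "dft_remainder r f x = sum_upto (dft r f) x - f r * of_real x"

definition has_mean_value :: "(nat \<Rightarrow> complex) \<Rightarrow> complex \<Rightarrow> bool" where
  "has_mean_value g m \<longleftrightarrow> ((\<lambda>x::real. of_real (1 / x) * sum_upto g x) \<longlongrightarrow> m) at_top"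

end

theory Submission
  imports Defs
begin

text \<open>
  Write \<open>f'\<close> for the Moebius transform of \<open>f\<close>. Moebius inversion together with \<open>r\<close>-evenness
  gives \<open>f(k) = \<Sum>\<^bsub>e | gcd(k,r)\<^esub> f'(e)\<close>, so \<open>f\<close> is a combination of the indicators
  of the multiples of \<open>e\<close>, for \<open>e | r\<close>. The Fourier transform of such an indicator is a geometric
  sum over the \<open>d\<close>-th roots of unity with \<open>d = r/e\<close>; it equals \<open>d\<close> at the multiples of \<open>d\<close>
  and vanishes elsewhere. Hence the transform of \<open>f\<close> at \<open>n\<close> is the Ramanujan-type sum
  \<open>\<Sum>\<^bsub>d | gcd(n,r)\<^esub> d f'(r/d)\<close> (lemma \<open>dft_r_even_eq\<close>).

  Counting the multiples of \<open>d\<close> up to \<open>x\<close> turns its summatory function into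
  \<open>\<Sum>\<^bsub>d | r\<^esub> d f'(r/d) \<lfloor>x/d\<rfloor>\<close> (lemma \<open>sum_upto_dft_r_even\<close>). Without the
  floors this would be \<open>x \<Sum>\<^bsub>d | r\<^esub> f'(r/d) = x f(r)\<close>, by inversion once more.
  So the error is \<open>\<Sum>\<^bsub>d | r\<^esub> d f'(r/d) (\<lfloor>x/d\<rfloor> - x/d)\<close>: it vanishes when
  \<open>r | x\<close>, because then every \<open>x/d\<close> is an integer, and it is bounded independently of \<open>x\<close>
  because a fractional part is less than 1. Boundedness yields the mean value.
\<close>

section \<open>Moebius inversion\<close>

lemma moebius_mu_prime_mult:
  assumes "prime p" "\<not> p dvd e"
  shows "moebius_mu (p * e) = - moebius_mu e"
proof (cases "squarefree e")
  case True
  have e: "e > 0" using assms(2) by (cases "e = 0") auto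
  have cop: "coprime p e" using assms by (simp add: prime_imp_coprime)
  have "prime_factors (p * e) = insert p (prime_factors e)"
    using assms e by (simp add: prime_factors_product prime_prime_factors)
  moreover have "p \<notin> prime_factors e" using assms(2) by auto
  moreover have "squarefree (p * e)"
    using True cop assms(1) by (simp add: squarefree_mult_coprime squarefree_prime)
  ultimately show ?thesis using True by (simp add: moebius_mu_def)
next
  case False
  then have "\<not> squarefree (p * e)" using squarefree_multD(2) by blast
  then show ?thesis using False by (simp add: moebius_mu_def)
qed

text \<open>
  For \<open>n > 1\<close>, fix a prime \<open>p | n\<close>. Divisors that are multiples of \<open>p\<^sup>2\<close> contribute nothing, and
  the other multiples of \<open>p\<close> are the \<open>pe\<close> with \<open>e | n\<close> prime to \<open>p\<close>; each of them cancels
  against \<open>e\<close>.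
\<close>
lemma sum_moebius_mu_divisors:
  assumes "n > 0"
  shows "(\<Sum>d | d dvd n. moebius_mu d) = (if n = 1 then 1 else 0)"
proof (cases "n = 1")
  case True
  then show ?thesis by (simp add: moebius_mu_def)
next
  case False
  obtain p where p: "prime p" "p dvd n" using False prime_factor_nat by blast
  let ?A = "{d. d dvd n \<and> \<not> p dvd d}" and ?B = "{d. d dvd n \<and> p dvd d}"
  have fin: "finite {d. d dvd n}" using assms by simp
  have finA: "finite ?A" "finite ?B" by (rule finite_subset[OF _ fin]; auto)+
  have p0: "p > 0" using p(1) by (simp add: prime_gt_0_nat)
  have sub: "(*) p ` ?A \<subseteq> ?B"
    using p by (auto intro!: divides_mult simp: prime_imp_coprime)
  have "(\<Sum>d\<in>?B. moebius_mu d) = (\<Sum>d\<in>(*) p ` ?A. moebius_mu d)"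
  proof (rule sum.mono_neutral_right[OF finA(2) sub], rule ballI)
    fix d assume d: "d \<in> ?B - (*) p ` ?A"
    then obtain e where e: "d = p * e" by auto
    have "p dvd e" using d e by (metis (no_types, lifting) DiffD1 DiffD2 dvd_mult_right
          image_eqI mem_Collect_eq)
    then have "p ^ 2 dvd d" using e by (simp add: power2_eq_square)
    then have "\<not> squarefree d" using p(1) squarefreeD not_prime_unit by blast
    then show "moebius_mu d = 0" by (simp add: moebius_mu_def)
  qed
  also have "\<dots> = (\<Sum>e\<in>?A. moebius_mu (p * e))"
    using p0 by (subst sum.reindex) (auto simp: inj_on_def)
  also have "\<dots> = (\<Sum>e\<in>?A. - moebius_mu e)"
    using p(1) by (intro sum.cong) (auto simp: moebius_mu_prime_mult)
  finally have "(\<Sum>d\<in>?B. moebius_mu d) = - (\<Sum>d\<in>?A. moebius_mu d)"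
    by (simp add: sum_negf)
  moreover have "(\<Sum>d | d dvd n. moebius_mu d) = (\<Sum>d\<in>?A. moebius_mu d) + (\<Sum>d\<in>?B. moebius_mu d)"
    by (subst sum.union_disjoint[OF finA, symmetric]) (auto intro!: sum.cong)
  ultimately show ?thesis using False by simp
qed

text \<open>
  Substituting \<open>c = e/d\<close> in the double sum over \<open>d | e | n\<close> collects the coefficient of \<open>f(c)\<close>,
  which is the sum of \<open>\<mu>\<close> over the divisors of \<open>n/c\<close>.
\<close>
lemma moebius_inversion:
  assumes "n > 0"
  shows "(\<Sum>e | e dvd n. moebius_transform f e) = f n"
proof -
  have pos: "m > 0" if "m dvd n" for m using that assms by (rule dvd_pos_nat[rotated])
  have pos': "n div m > 0" if "m dvd n" for m
    using that assms by auto
  have "(\<Sum>e | e dvd n. moebius_transform f e)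
      = (\<Sum>(e, d)\<in>(SIGMA e:{e. e dvd n}. {d. d dvd e}). moebius_mu d * f (e div d))"
    unfolding moebius_transform_def dirichlet_conv_def
    using assms pos by (intro sum.Sigma) auto
  also have "\<dots> = (\<Sum>(c, d)\<in>(SIGMA c:{c. c dvd n}. {d. d dvd n div c}). moebius_mu d * f c)"
  proof (rule sum.reindex_bij_witness[where i = "\<lambda>(c, d). (c * d, d)" and j = "\<lambda>(e, d). (e div d, d)"],
      goal_cases)
    case (1 a) then show ?case by auto
  next
    case (2 a)
    obtain e d where [simp]: "a = (e, d)" by force
    have "d dvd e" "e dvd n" using 2 by auto
    then obtain k l where [simp]: "e = d * k" "n = d * k * l" by (auto elim!: dvdE)
    have "d > 0" "k > 0" using assms by auto
    then show ?case using assms by (auto simp: mult.assoc mult.left_commute)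
  next
    case (3 b)
    obtain c d where [simp]: "b = (c, d)" by force
    have cn: "c dvd n" "d dvd n div c" using 3 by auto
    have "d > 0" using cn pos' dvd_pos_nat by blast
    then show ?case by simp
  next
    case (4 b)
    obtain c d where [simp]: "b = (c, d)" by force
    have cn: "c dvd n" "d dvd n div c" using 4 by auto
    then have "c * d dvd n" by (metis dvd_mult_div_cancel mult_dvd_mono dvd_refl)
    then show ?case by simp
  next
    case (5 a) then show ?case by auto
  qed
  also have "\<dots> = (\<Sum>c | c dvd n. \<Sum>d | d dvd n div c. moebius_mu d * f c)"
    using assms pos' by (intro sum.Sigma[symmetric]) auto
  also have "\<dots> = (\<Sum>c | c dvd n. if c = n then f n else 0)"
  proof (rule sum.cong[OF refl])
    fix c assume "c \<in> {c. c dvd n}"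
    then have c: "c dvd n" by simp
    have "n div c = 1 \<longleftrightarrow> c = n" using c assms by (auto elim!: dvdE)
    then show "(\<Sum>d | d dvd n div c. moebius_mu d * f c) = (if c = n then f n else 0)"
      using sum_moebius_mu_divisors[OF pos'[OF c]]
      by (simp flip: sum_distrib_right)
  qed
  also have "\<dots> = f n" using assms by (simp add: sum.delta)
  finally show ?thesis .
qed

section \<open>The transform of an even function\<close>

lemma sum_powers_root_of_unity:
  fixes w :: complex
  assumes "w ^ d = 1"
  shows "(\<Sum>j=1..d. w ^ j) = (if w = 1 then of_nat d else 0)"
proof (cases "w = 1")
  case False
  have "(\<Sum>j=1..d. w ^ j) = w * (\<Sum>j<d. w ^ j)"
    by (simp add: sum_distrib_left sum.atLeast1_atMost_eq)
  also have "(\<Sum>j<d. w ^ j) = 0" using False assms by (simp add: geometric_sum)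
  finally show ?thesis using False by simp
qed simp

lemma exp_minus_two_pi_i_eq_1_iff:
  assumes "d > 0"
  shows "exp (- 2 * of_real pi * \<i> * of_nat n / of_nat d) = (1::complex) \<longleftrightarrow> d dvd n"
proof -
  have eq: "exp (- 2 * of_real pi * \<i> * of_nat n / of_nat d) = cis (- (2 * pi * (real n / real d)))"
    by (simp add: cis_conv_exp mult_ac)
  \<comment> \<open>A cosine equal to 1 forces the sine to vanish, so the real part alone decides.\<close>
  have "cis (- (2 * pi * (real n / real d))) = 1 \<longleftrightarrow> (cos (2 * pi * (real n / real d)) = 1)"
    using cos_one_sin_zero by (auto simp: complex_eq_iff)
  also have "\<dots> \<longleftrightarrow> (\<exists>m::int. 2 * pi * (real n / real d) = of_int m * 2 * pi)"
    by (rule cos_one_2pi_int)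
  also have "\<dots> \<longleftrightarrow> (\<exists>m::int. real n = of_int m * real d)"
    using assms by (simp add: field_simps)
  also have "\<dots> \<longleftrightarrow> (\<exists>m::int. int n = m * int d)"
    by (metis of_int_eq_iff of_int_mult of_int_of_nat_eq)
  also have "\<dots> \<longleftrightarrow> d dvd n"
    by (metis dvd_def int_dvd_int_iff mult.commute)
  finally show ?thesis using eq by simp
qed

text \<open>
  The transform of the indicator of the multiples of \<open>e\<close>: on \<open>k = ej\<close> the exponential is the
  \<open>j\<close>-th power of a single \<open>r/e\<close>-th root of unity.
\<close>
lemma exp_sum_over_multiples:
  assumes "r > 0" "e dvd r"
  shows "(\<Sum>k | k \<in> {1..r} \<and> e dvd k. exp (- 2 * of_real pi * \<i> * of_nat k * of_nat n / of_nat r))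
    = (if r div e dvd n then of_nat (r div e) else (0::complex))"
proof -
  define d where "d = r div e"
  have r: "r = e * d" using assms by (simp add: d_def)
  have pos: "e > 0" "d > 0" using assms r by auto
  define w :: complex where "w = exp (- 2 * of_real pi * \<i> * of_nat n / of_nat d)"
  have w1: "w = 1 \<longleftrightarrow> d dvd n" unfolding w_def by (rule exp_minus_two_pi_i_eq_1_iff[OF pos(2)])
  have pw: "w ^ j = exp (- 2 * of_real pi * \<i> * of_nat (j * n) / of_nat d)" for j
    by (simp add: w_def exp_of_nat_mult[symmetric] mult_ac)
  have wd: "w ^ d = 1" unfolding pw exp_minus_two_pi_i_eq_1_iff[OF pos(2)] by simp
  have "(\<Sum>k | k \<in> {1..r} \<and> e dvd k. exp (- 2 * of_real pi * \<i> * of_nat k * of_nat n / of_nat r))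
      = (\<Sum>j=1..d. w ^ j)"
    by (rule sum.reindex_bij_witness[where i = "\<lambda>j. e * j" and j = "\<lambda>k. k div e"])
       (use pos in \<open>auto simp: r pw mult_ac\<close>)
  also have "\<dots> = (if w = 1 then of_nat d else 0)" by (rule sum_powers_root_of_unity[OF wd])
  finally show ?thesis using w1 by (simp add: d_def)
qed

lemma div_div_divisor:
  fixes d r :: nat
  assumes "d dvd r" "r > 0"
  shows "r div (r div d) = d"
  using assms by auto

lemma sum_divisors_complement:
  fixes g :: "nat \<Rightarrow> 'a::comm_monoid_add"
  assumes "r > 0"
  shows "(\<Sum>d | d dvd r. g (r div d)) = (\<Sum>d | d dvd r. g d)"
  by (rule sum.reindex_bij_witness[where i = "\<lambda>d. r div d" and j = "\<lambda>d. r div d"])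
     (use assms in \<open>auto simp: div_div_divisor\<close>)

text \<open>
  Expanding \<open>f\<close> on \<open>{1..r}\<close> by Moebius inversion at \<open>gcd(k,r)\<close> and swapping the sums leaves
  the transforms of indicators of multiples of \<open>e\<close>; the result is then indexed by the
  complementary divisor \<open>d = r/e\<close>.
\<close>
lemma dft_r_even_eq:
  assumes "r > 0" "r_even r f"
  shows "dft r f n = (\<Sum>d | d dvd r. if d dvd n then of_nat d * moebius_transform f (r div d) else 0)"
proof -
  let ?E = "\<lambda>k. exp (- 2 * of_real pi * \<i> * of_nat k * of_nat n / of_nat r) :: complex"
  let ?F = "moebius_transform f"
  have fin: "finite {d. d dvd r}" using assms(1) by simp
  have f: "f k = (\<Sum>e | e dvd r. if e dvd k then ?F e else 0)" if "k \<in> {1..r}" for k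
  proof -
    have "f k = f (gcd k r)" using assms(2) that by (simp add: r_even_def)
    also have "\<dots> = (\<Sum>e | e dvd gcd k r. ?F e)"
      using assms(1) by (intro moebius_inversion[symmetric]) simp
    also have "\<dots> = (\<Sum>e\<in>{e \<in> {e. e dvd r}. e dvd k}. ?F e)" by (rule sum.cong) auto
    also have "\<dots> = (\<Sum>e | e dvd r. if e dvd k then ?F e else 0)"
      by (rule sum.inter_filter[OF fin])
    finally show ?thesis .
  qed
  have "dft r f n = (\<Sum>k=1..r. \<Sum>e | e dvd r. ?F e * (if e dvd k then ?E k else 0))"
    unfolding dft_def using f by (auto intro!: sum.cong simp: sum_distrib_right)
  also have "\<dots> = (\<Sum>e | e dvd r. ?F e * (\<Sum>k=1..r. if e dvd k then ?E k else 0))"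
    by (subst sum.swap) (simp add: sum_distrib_left)
  also have "\<dots> = (\<Sum>e | e dvd r. ?F e * (if r div e dvd n then of_nat (r div e) else 0))"
  proof (rule sum.cong[OF refl])
    fix e assume "e \<in> {e. e dvd r}"
    then have e: "e dvd r" by simp
    have "(\<Sum>k=1..r. if e dvd k then ?E k else 0) = (\<Sum>k\<in>{k \<in> {1..r}. e dvd k}. ?E k)"
      by (rule sum.inter_filter[symmetric]) simp
    then show "?F e * (\<Sum>k=1..r. if e dvd k then ?E k else 0)
        = ?F e * (if r div e dvd n then of_nat (r div e) else 0)"
      using exp_sum_over_multiples[OF assms(1) e] by simp
  qed
  also have "\<dots> = (\<Sum>d | d dvd r. ?F (r div d) *
      (if r div (r div d) dvd n then of_nat (r div (r div d)) else 0))"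
    by (rule sum_divisors_complement[OF assms(1), symmetric])
  also have "\<dots> = (\<Sum>d | d dvd r. if d dvd n then of_nat d * ?F (r div d) else 0)"
    using assms(1) by (intro sum.cong) (auto simp: div_div_divisor)
  finally show ?thesis .
qed

section \<open>The summatory function and its error term\<close>

lemma card_multiples_upto_real:
  fixes x :: real
  assumes "d > 0" "x \<ge> 0"
  shows "card {n. (0 < n \<and> real n \<le> x) \<and> d dvd n} = nat \<lfloor>x / real d\<rfloor>"
proof -
  have "{n. (0 < n \<and> real n \<le> x) \<and> d dvd n} = (*) d ` {1..nat \<lfloor>x / real d\<rfloor>}"
  proof safe
    fix n assume n: "0 < n" "real n \<le> x" "d dvd n"
    then obtain m where m: "n = d * m" by auto
    have "real m \<le> x / real d" using n m assms by (simp add: field_simps)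
    then have "m \<le> nat \<lfloor>x / real d\<rfloor>" by (simp add: le_nat_floor)
    then show "n \<in> (*) d ` {1..nat \<lfloor>x / real d\<rfloor>}" using m n by (intro image_eqI) auto
  next
    fix m assume m: "m \<in> {1..nat \<lfloor>x / real d\<rfloor>}"
    then show "0 < d * m" using assms by simp
    have "real m \<le> x / real d" using m assms by (auto simp: nat_le_eq_zle le_nat_iff le_floor_iff)
    then show "real (d * m) \<le> x" using assms by (simp add: field_simps)
  qed auto
  then show ?thesis using assms by (simp add: card_image inj_on_def)
qed

lemma sum_upto_dft_r_even:
  assumes "r > 0" "r_even r f" "x \<ge> 0"
  shows "sum_upto (dft r f) x
    = (\<Sum>d | d dvd r. of_nat d * moebius_transform f (r div d) * of_int \<lfloor>x / real d\<rfloor>)"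
proof -
  let ?N = "{n. 0 < n \<and> real n \<le> x}"
  have "?N \<subseteq> {..nat \<lfloor>x\<rfloor>}" by (auto simp: le_nat_floor)
  then have fin: "finite ?N" by (rule finite_subset) simp
  have "sum_upto (dft r f) x
      = (\<Sum>d | d dvd r. \<Sum>n\<in>?N. if d dvd n then of_nat d * moebius_transform f (r div d) else 0)"
    unfolding sum_upto_def using assms by (subst sum.swap) (simp add: dft_r_even_eq)
  also have "\<dots> = (\<Sum>d | d dvd r. of_nat d * moebius_transform f (r div d) * of_int \<lfloor>x / real d\<rfloor>)"
  proof (rule sum.cong[OF refl])
    fix d assume "d \<in> {d. d dvd r}"
    then have d: "d > 0" using assms(1) by (auto intro: dvd_pos_nat)
    let ?c = "of_nat d * moebius_transform f (r div d)"
    have "(\<Sum>n\<in>?N. if d dvd n then ?c else 0) = (\<Sum>n\<in>{n \<in> ?N. d dvd n}. ?c)"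
      by (rule sum.inter_filter[OF fin, symmetric])
    also have "\<dots> = of_nat (nat \<lfloor>x / real d\<rfloor>) * ?c"
      using card_multiples_upto_real[OF d assms(3)] by simp
    also have "\<dots> = ?c * of_int \<lfloor>x / real d\<rfloor>"
      using assms(3) by (simp add: of_nat_nat)
    finally show "(\<Sum>n\<in>?N. if d dvd n then ?c else 0) = ?c * of_int \<lfloor>x / real d\<rfloor>" .
  qed
  finally show ?thesis .
qed

text \<open>
  The main term is \<open>x \<Sum>\<^bsub>d | r\<^esub> f'(r/d)\<close> by inversion at \<open>r\<close>; written as
  \<open>\<Sum>\<^bsub>d | r\<^esub> d f'(r/d) (x/d)\<close>, it is subtracted term by term, and a fractional part
  remains from each.
\<close>
lemma dft_remainder_r_even:
  assumes "r > 0" "r_even r f" "x \<ge> 0"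
  shows "dft_remainder r f x
    = - (\<Sum>d | d dvd r. of_nat d * moebius_transform f (r div d) * of_real (frac (x / real d)))"
proof -
  have "f r = (\<Sum>d | d dvd r. moebius_transform f (r div d))"
    using assms(1) by (simp add: sum_divisors_complement moebius_inversion)
  then have "f r * of_real x
      = (\<Sum>d | d dvd r. of_nat d * moebius_transform f (r div d) * of_real (x / real d))"
    using assms(1) by (auto simp: sum_distrib_right intro!: sum.cong)
  then show ?thesis
    unfolding dft_remainder_def sum_upto_dft_r_even[OF assms]
    by (simp add: frac_def sum_subtractf[symmetric] sum_negf[symmetric] algebra_simps)
qed

lemma dft_remainder_bound:
  assumes "r > 0" "r_even r f" "x \<ge> 0"
  shows "cmod (dft_remainder r f x)
    \<le> (\<Sum>d | d dvd r. real d * cmod (moebius_transform f (r div d)))"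
  unfolding dft_remainder_r_even[OF assms] norm_minus_cancel
proof (rule sum_norm_le)
  fix d
  have "0 \<le> frac (x / real d)" "frac (x / real d) \<le> 1"
    by (auto intro: less_imp_le[OF frac_lt_1])
  then show "cmod (of_nat d * moebius_transform f (r div d) * of_real (frac (x / real d)))
      \<le> real d * cmod (moebius_transform f (r div d))"
    by (simp add: norm_mult mult_left_le)
qed

lemma dft_remainder_eq_0:
  assumes "r > 0" "r_even r f" "r dvd x"
  shows "dft_remainder r f (real x) = 0"
proof -
  have "frac (real x / real d) = 0" if "d dvd r" for d
  proof -
    have "d dvd x" using that assms(3) by (rule dvd_trans)
    then have "real x / real d = of_nat (x div d)" by (simp add: real_of_nat_div)
    then show ?thesis by simp
  qed
  then show ?thesis using assms by (simp add: dft_remainder_r_even del: frac_eq_0_iff)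
qed

lemma has_mean_value_dft:
  assumes "r > 0" "r_even r f"
  shows "has_mean_value (dft r f) (f r)"
proof -
  define C where "C = (\<Sum>d | d dvd r. real d * cmod (moebius_transform f (r div d)))"
  have "((\<lambda>x. of_real (1 / x) * sum_upto (dft r f) x - f r) \<longlongrightarrow> 0) at_top"
  proof (rule tendsto_0_le)
    show "((\<lambda>x::real. inverse x) \<longlongrightarrow> 0) at_top"
      by (rule tendsto_inverse_0_at_top[OF filterlim_ident])
    show "\<forall>\<^sub>F x in at_top. cmod (of_real (1 / x) * sum_upto (dft r f) x - f r)
        \<le> norm (inverse x) * C"
      using eventually_ge_at_top[of "1::real"]
    proof eventually_elim
      case (elim x)
      have "of_real (1 / x) * sum_upto (dft r f) x - f r = dft_remainder r f x / of_real x"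
        using elim by (simp add: dft_remainder_def field_simps)
      then show ?case
        using dft_remainder_bound[OF assms, of x] elim
        by (simp add: C_def norm_divide field_simps)
    qed
  qed
  then show ?thesis unfolding has_mean_value_def by (rule LIM_zero_cancel)
qed

theorem proposition9:
  fixes r :: nat and f :: "nat \<Rightarrow> complex"
  assumes "r > 0" and "r_even r f"
  shows "(\<forall>x::nat. x > 0 \<longrightarrow> r dvd x \<longrightarrow> (\<Sum>n=1..x. dft r f n) = f r * of_nat x) \<and>
         (\<forall>x::real. x \<ge> 1 \<longrightarrow>
            sum_upto (dft r f) x = f r * of_real x + dft_remainder r f x \<and>
            cmod (dft_remainder r f x)
              \<le> (\<Sum>d | d dvd r. real d * cmod (moebius_transform f (r div d)))) \<and>
         has_mean_value (dft r f) (f r)"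
proof (intro conjI allI impI)
  fix x :: nat assume "r dvd x"
  have "{n. 0 < n \<and> real n \<le> real x} = {1..x}" by auto
  then have "(\<Sum>n=1..x. dft r f n) = sum_upto (dft r f) (real x)" by (simp add: sum_upto_def)
  then show "(\<Sum>n=1..x. dft r f n) = f r * of_nat x"
    using dft_remainder_eq_0[OF assms \<open>r dvd x\<close>] by (simp add: dft_remainder_def)
next
  fix x :: real assume "x \<ge> 1"
  show "sum_upto (dft r f) x = f r * of_real x + dft_remainder r f x"
    by (simp add: dft_remainder_def)
  show "cmod (dft_remainder r f x)
      \<le> (\<Sum>d | d dvd r. real d * cmod (moebius_transform f (r div d)))"
    using dft_remainder_bound[OF assms] \<open>x \<ge> 1\<close> by simp
next
  show "has_mean_value (dft r f) (f r)" by (rule has_mean_value_dft[OF assms])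
qed

end
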